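(* Let $K$ be a field, $A$ a Noetherian $K$-algebra, $R_A=A[x_1,\dots,x_n]$, and let $\mathcal O$ be a finite order ideal of terms, with border $\partial\mathcal O$ (its terms ordered arbitrarily) and with $\mathcal P_{\mathcal O}\subseteq\partial\mathcal O$ the Pommaret basis of the monomial ideal generated by the terms outside $\mathcal O$. Let $B\subset R_A$ be a $\partial\mathcal O$-marked set, let $P$ be the $\mathcal P_{\mathcal O}$-marked set contained in $B$ (i.e. the set of marked polynomials of $B$ whose head terms belong to $\mathcal P_{\mathcal O}$), and let $B'=B\setminus P$. Then $B$ is a $\partial\mathcal O$-marked basis if and only if $P$ is a $\mathcal P_{\mathcal O}$-marked basis and $B'\subset (P)$, where $(P)$ is the ideal of $R_A$ generated by $P$.
   Context: $\mathbb T$ is the set of terms (monic monomials) in the variables $x_1<\dots<x_n$ (an ordering of the variables only, not a term order). For a term $\tau\neq 1$, $\min(\tau)$ is the smallest variable dividing $\tau$. An order ideal is a (nonempty) set $\mathcal O\subseteq\mathbb T$ such that every term dividing an element of $\mathcal O$ belongs to $\mathcal O$. For a finite order ideal $\mathcal O$, the border is $\partial\mathcal O=\{x_i\tau : \tau\in\mathcal O,\ 1\le i\le n\}\setminus\mathcal O$. The Pommaret basis $\mathcal P_{\mathcal O}$ of the monomial ideal $J$ generated by $\mathbb T\setminus\mathcal O$ is the set of terms $\sigma\in J$ with $\sigma/\min(\sigma)\notin J$; it is finite and contained in $\partial\mathcal O$. A marked polynomial is a polynomial $f$ together with a specified term $\mathrm{Ht}(f)$ of its support (its head term) that occurs in $f$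 with coefficient $1$. For $\mathcal H=\partial\mathcal O$ or $\mathcal H=\mathcal P_{\mathcal O}$, an $\mathcal H$-marked set in $R_A$ is a set $F=\{f_\alpha : \alpha\in\mathcal H\}$ of exactly $|\mathcal H|$ marked polynomials with $\mathrm{Ht}(f_\alpha)=\alpha$ and such that $f_\alpha-\alpha$ is an $A$-linear combination of terms of $\mathcal O$. (These are the marked sets for the border reduction structure, respectively the Pommaret reduction structure, in both of which all tail sets equal $\mathcal O$.) An $\mathcal H$-marked set $F$ is an $\mathcal H$-marked basis if $R_A=(F)\oplus\langle\mathcal O\rangle_A$, where $(F)$ is the ideal of $R_A$ generated by $F$ and $\langle\mathcal O\rangle_A$ is the $A$-submodule of $R_A$ generated by $\mathcal O$. *)

theory Defs
  imports Complex_Main "HOL-Library.Poly_Mapping"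
begin

text \<open>
  The variables \<open>x\<^sub>1 < \<dots> < x\<^sub>n\<close> are the elements of a finite linearly ordered type \<open>'x\<close>.
  A term is its exponent vector, so \<open>1\<close> is written \<open>0\<close>, and multiplication and division of terms
  are written \<open>+\<close> and \<open>-\<close>. Multiplication of polynomials is the convolution of
  \<^theory>\<open>HOL-Library.Poly_Mapping\<close>.
\<close>

type_synonym 'x pp = "'x \<Rightarrow>\<^sub>0 nat"
type_synonym ('x, 'a) mpoly = "'x pp \<Rightarrow>\<^sub>0 'a"

definition monom :: "'x pp \<Rightarrow> ('x, 'a::comm_ring_1) mpoly" where
  "monom \<tau> = Poly_Mapping.single \<tau> 1"

definition var :: "'x \<Rightarrow> 'x pp" where
  "var x = Poly_Mapping.single x 1"

text \<open>
  The order \<open>\<le>\<close> that the library puts on \<^typ>\<open>'x pp\<close> is lexicographic, and \<open>dvd\<close> does not apply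
  to the additive notation; divisibility of terms is therefore defined here.
\<close>

definition pp_dvd :: "'x pp \<Rightarrow> 'x pp \<Rightarrow> bool" where
  "pp_dvd \<sigma> \<tau> \<longleftrightarrow> (\<exists>\<upsilon>. \<tau> = \<sigma> + \<upsilon>)"

definition min_var :: "'x::linorder pp \<Rightarrow> 'x" where
  "min_var \<tau> = Min {x. pp_dvd (var x) \<tau>}"


subsection \<open>Algebras, ideals, submodules\<close>

locale K_algebra = vector_space scale
  for scale :: "'k::field \<Rightarrow> 'a::comm_ring_1 \<Rightarrow> 'a" +
  assumes scale_mult_left: "scale c (a * b) = scale c a * b"

text \<open>
  Ideals of a commutative ring are its submodules when it acts on itself by multiplication. The
  lemma makes the facts of the locale \<^locale>\<open>module\<close> available for them.
\<close>

lemma module_mult: "module ((*) :: 'r::comm_ring_1 \<Rightarrow> 'r \<Rightarrow> 'r)"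
  by unfold_locales (simp_all add: algebra_simps)

definition is_ideal :: "'r::comm_ring_1 set \<Rightarrow> bool" where
  "is_ideal I \<longleftrightarrow> module.subspace (*) I"

definition ideal_gen :: "'r::comm_ring_1 set \<Rightarrow> 'r set" where
  "ideal_gen S = module.span (*) S"

definition noetherian :: "'r::comm_ring_1 itself \<Rightarrow> bool" where
  "noetherian _ \<longleftrightarrow> (\<forall>I :: 'r set. is_ideal I \<longrightarrow> (\<exists>S. finite S \<and> I = ideal_gen S))"

definition coeff_scale :: "'a::comm_ring_1 \<Rightarrow> ('x, 'a) mpoly \<Rightarrow> ('x, 'a) mpoly" where
  "coeff_scale a p = Poly_Mapping.single 0 a * p"

lemma module_coeff_scale:
  "module (coeff_scale :: 'a::comm_ring_1 \<Rightarrow> ('x, 'a) mpoly \<Rightarrow> ('x, 'a) mpoly)"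
  by unfold_locales
    (simp_all add: coeff_scale_def algebra_simps single_add mult_single
      flip: mult.assoc)

definition term_module :: "'x pp set \<Rightarrow> ('x, 'a::comm_ring_1) mpoly set" where
  "term_module \<O> = module.span coeff_scale (monom ` \<O>)"

definition whole_is_direct_sum :: "'r::comm_monoid_add set \<Rightarrow> 'r set \<Rightarrow> bool" where
  "whole_is_direct_sum U V \<longleftrightarrow> {u + v | u v. u \<in> U \<and> v \<in> V} = UNIV \<and> U \<inter> V = {0}"


subsection \<open>Order ideals, borders, Pommaret bases\<close>

definition order_ideal :: "'x pp set \<Rightarrow> bool" where
  "order_ideal \<O> \<longleftrightarrow> \<O> \<noteq> {} \<and> (\<forall>\<tau>\<in>\<O>. \<forall>\<sigma>. pp_dvd \<sigma> \<tau> \<longrightarrow> \<sigma> \<in> \<O>)"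

definition border :: "'x pp set \<Rightarrow> 'x pp set" where
  "border \<O> = {var x + \<tau> | x \<tau>. \<tau> \<in> \<O>} - \<O>"

definition complement_ideal :: "'x pp set \<Rightarrow> ('x, 'a::comm_ring_1) mpoly set" where
  "complement_ideal \<O> = ideal_gen (monom ` (- \<O>))"

text \<open>
  The condition \<open>\<sigma> \<noteq> 0\<close> says that \<open>\<sigma>\<close> is not the term \<open>1\<close>, for which \<^const>\<open>min_var\<close> is
  unspecified; it is automatic for the ideals \<^term>\<open>complement_ideal \<O>\<close> with \<open>\<O>\<close> an order ideal,
  which are proper.
\<close>

definition pommaret_basis :: "('x::linorder, 'a::comm_ring_1) mpoly set \<Rightarrow> 'x pp set" where
  "pommaret_basis J =
     {\<sigma>. monom \<sigma> \<in> J \<and> \<sigma> \<noteq> 0 \<and> monom (\<sigma> - var (min_var \<sigma>)) \<notin> J}"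


subsection \<open>Marked sets and marked bases\<close>

text \<open>A polynomial together with the term specified as its head term.\<close>

type_synonym ('x, 'a) marked = "('x, 'a) mpoly \<times> 'x pp"

abbreviation poly_of :: "('x, 'a::comm_ring_1) marked \<Rightarrow> ('x, 'a) mpoly" where
  "poly_of \<equiv> fst"

abbreviation Ht :: "('x, 'a::comm_ring_1) marked \<Rightarrow> 'x pp" where
  "Ht \<equiv> snd"

definition is_marked_polynomial :: "('x, 'a::comm_ring_1) marked \<Rightarrow> bool" where
  "is_marked_polynomial f \<longleftrightarrow>
     Ht f \<in> Poly_Mapping.keys (poly_of f) \<and> Poly_Mapping.lookup (poly_of f) (Ht f) = 1"

definition marked_set ::
  "'x pp set \<Rightarrow> 'x pp set \<Rightarrow> ('x, 'a::comm_ring_1) marked set \<Rightarrow> bool" where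
  "marked_set \<O> H F \<longleftrightarrow>
     (\<forall>f\<in>F. is_marked_polynomial f) \<and>
     bij_betw Ht F H \<and>
     (\<forall>f\<in>F. poly_of f - monom (Ht f) \<in> term_module \<O>)"

definition marked_basis ::
  "'x pp set \<Rightarrow> 'x pp set \<Rightarrow> ('x, 'a::comm_ring_1) marked set \<Rightarrow> bool" where
  "marked_basis \<O> H F \<longleftrightarrow>
     marked_set \<O> H F \<and> whole_is_direct_sum (ideal_gen (poly_of ` F)) (term_module \<O>)"

end

theory Submission
  imports Defs
begin

text \<open>
  Let \<open>P\<close> be marked on the Pommaret basis. The point is that \<open>V = (P) + \<langle>\<O>\<rangle>\<close> is always the whole
  polynomial ring, so that only the directness of the sum is in question. As \<open>V\<close> is an
  \<open>A\<close>-submodule containing \<open>1\<close>, it suffices to see that \<open>V\<close> is closed under multiplication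
  by each variable, which is shown by induction on the variable \<open>x\<close>
  (\<open>var_mult_closed\<close>). The summand \<open>(P)\<close> is closed under it, so only the products \<open>x \<tau>\<close> with
  \<open>\<tau> \<in> \<O>\<close> and \<open>x \<tau> \<notin> \<O>\<close> matter. Such a term is
  \<open>\<alpha> \<eta>\<close> with \<open>\<alpha>\<close> in the Pommaret basis and no variable of \<open>\<eta>\<close> larger than \<open>min(\<alpha>)\<close>
  (\<open>pommaret_decomposition\<close>). All variables of \<open>\<eta>\<close> are then smaller than \<open>x\<close>: if \<open>x\<close>
  divided \<open>\<eta>\<close>, then \<open>\<alpha>\<close> would divide \<open>\<tau> \<in> \<O>\<close>; and if a larger variable divided \<open>\<eta>\<close>, then
  \<open>x\<close> could divide neither \<open>\<eta>\<close> nor \<open>\<alpha>\<close>. Modulo \<open>(P)\<close> the term \<open>\<alpha> \<eta>\<close> equals, up to sign, \<open>\<eta>\<close> times the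
  tail of the polynomial marked on \<open>\<alpha>\<close>; this tail is in \<open>V\<close>, and multiplication by \<open>\<eta>\<close>
  preserves \<open>V\<close> by the induction hypothesis.

  Now let \<open>B\<close> be a basis. Then \<open>(P) \<inter> \<langle>\<O>\<rangle> \<subseteq> (B) \<inter> \<langle>\<O>\<rangle> = 0\<close>, so \<open>P\<close> is a basis, and two ideals
  \<open>(P) \<subseteq> (B)\<close> with a common complement are equal, which gives \<open>B' \<subseteq> (P)\<close>. Conversely,
  \<open>B' \<subseteq> (P)\<close> means \<open>(B) = (P)\<close>, and the direct sum for \<open>P\<close> is the one for \<open>B\<close>.
\<close>

interpretation ideal: module "(*) :: 'r::comm_ring_1 \<Rightarrow> 'r \<Rightarrow> 'r"
  by (rule module_mult)

interpretation coeff: module "coeff_scale :: 'a::comm_ring_1 \<Rightarrow> ('x, 'a) mpoly \<Rightarrow> ('x, 'a) mpoly"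
  by (rule module_coeff_scale)


section \<open>Terms and the Pommaret decomposition\<close>

lemma var_add_diff: "x \<in> Poly_Mapping.keys \<tau> \<Longrightarrow> var x + (\<tau> - var x) = \<tau>"
  by (rule poly_mapping_eqI)
    (auto simp: var_def lookup_add lookup_minus lookup_single when_def in_keys_iff)

lemma keys_add_pp:
  "Poly_Mapping.keys (\<sigma> + \<tau>) = Poly_Mapping.keys \<sigma> \<union> Poly_Mapping.keys (\<tau> :: 'x pp)"
  by (auto simp: in_keys_iff lookup_add)

lemma keys_var [simp]: "Poly_Mapping.keys (var x) = {x}"
  by (simp add: var_def)

lemma pp_dvd_var_iff: "pp_dvd (var x) \<tau> \<longleftrightarrow> x \<in> Poly_Mapping.keys \<tau>"
  unfolding pp_dvd_def by (metis var_add_diff keys_add_pp keys_var UnI1 singletonI)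

lemma min_var_eq: "min_var \<tau> = Min (Poly_Mapping.keys \<tau>)"
  by (simp add: min_var_def pp_dvd_var_iff)

lemma min_var_in_keys: "\<tau> \<noteq> 0 \<Longrightarrow> min_var \<tau> \<in> Poly_Mapping.keys \<tau>"
  by (simp add: min_var_eq)

lemma min_var_le: "x \<in> Poly_Mapping.keys \<tau> \<Longrightarrow> min_var \<tau> \<le> x"
  by (simp add: min_var_eq)

text \<open>
  The hypothesis covers division by every variable of \<open>\<tau>\<close>, so that a proof may choose the
  variable that it divides by.
\<close>

lemma pp_var_induct:
  assumes step: "\<And>\<tau>. (\<And>x. x \<in> Poly_Mapping.keys \<tau> \<Longrightarrow> Q (\<tau> - var x)) \<Longrightarrow> Q \<tau>"
  shows "Q (\<tau> :: 'x pp)"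
proof (induction "\<Sum>y\<in>Poly_Mapping.keys \<tau>. Poly_Mapping.lookup \<tau> y" arbitrary: \<tau> rule: less_induct)
  case less
  show ?case
  proof (rule step)
    fix x assume x: "x \<in> Poly_Mapping.keys \<tau>"
    define \<upsilon> where "\<upsilon> = \<tau> - var x"
    have \<tau>: "\<tau> = var x + \<upsilon>"
      using var_add_diff[OF x] by (simp add: \<upsilon>_def)
    have "(\<Sum>y\<in>Poly_Mapping.keys \<upsilon>. Poly_Mapping.lookup \<upsilon> y)
        = (\<Sum>y\<in>Poly_Mapping.keys \<tau>. Poly_Mapping.lookup \<upsilon> y)"
      by (rule sum.mono_neutral_left) (auto simp: \<tau> keys_add_pp in_keys_iff)
    also have "\<dots> < (\<Sum>y\<in>Poly_Mapping.keys \<tau>. Poly_Mapping.lookup \<tau> y)"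
      by (rule sum_strict_mono_ex1) (auto simp: \<tau> lookup_add var_def keys_add_pp intro: bexI[of _ x])
    finally show "Q (\<tau> - var x)"
      unfolding \<upsilon>_def[symmetric] by (rule less)
  qed
qed

lemma order_ideal_zero: "order_ideal \<O> \<Longrightarrow> 0 \<in> \<O>"
  unfolding order_ideal_def pp_dvd_def by (metis add_0 ex_in_conv)

lemma order_ideal_addD: "order_ideal \<O> \<Longrightarrow> \<sigma> + \<tau> \<in> \<O> \<Longrightarrow> \<sigma> \<in> \<O>"
  unfolding order_ideal_def pp_dvd_def by blast

lemma keys_monom [simp]: "Poly_Mapping.keys (monom \<tau> :: ('x, 'a::comm_ring_1) mpoly) = {\<tau>}"
  by (simp add: monom_def)

lemma monom_add: "monom (\<sigma> + \<tau>) = (monom \<sigma> * monom \<tau> :: ('x, 'a::comm_ring_1) mpoly)"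
  by (simp add: monom_def mult_single)

text \<open>
  The polynomials supported outside \<open>\<O>\<close> form an ideal, because multiples of terms outside an order
  ideal stay outside; it contains the generators of the complement ideal.
\<close>

lemma monom_in_complement_ideal_iff:
  assumes "order_ideal \<O>"
  shows "monom \<sigma> \<in> (complement_ideal \<O> :: ('x, 'a::comm_ring_1) mpoly set) \<longleftrightarrow> \<sigma> \<notin> \<O>"
proof
  let ?S = "{p :: ('x, 'a) mpoly. Poly_Mapping.keys p \<subseteq> - \<O>}"
  have "c * p \<in> ?S" if "p \<in> ?S" for c p :: "('x, 'a) mpoly"
  proof -
    have "\<tau> \<notin> \<O>" if \<tau>: "\<tau> \<in> Poly_Mapping.keys (c * p)" for \<tau>
    proof -
      obtain \<mu> \<nu> where "\<tau> = \<nu> + \<mu>" "\<nu> \<in> Poly_Mapping.keys p"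
        using \<tau> keys_mult[of c p] by (auto simp: add.commute)
      then show ?thesis
        using \<open>p \<in> ?S\<close> order_ideal_addD[OF assms] by blast
    qed
    then show ?thesis
      by blast
  qed
  moreover have "p + q \<in> ?S" if "p \<in> ?S" "q \<in> ?S" for p q :: "('x, 'a) mpoly"
    using that Poly_Mapping.keys_add[of p q] by auto
  ultimately have "ideal.subspace ?S"
    by (intro ideal.subspaceI) simp_all
  then have "complement_ideal \<O> \<subseteq> ?S"
    unfolding complement_ideal_def ideal_gen_def by (intro ideal.span_minimal) auto
  then show "monom \<sigma> \<in> (complement_ideal \<O> :: ('x, 'a) mpoly set) \<Longrightarrow> \<sigma> \<notin> \<O>"
    by auto
next
  show "\<sigma> \<notin> \<O> \<Longrightarrow> monom \<sigma> \<in> (complement_ideal \<O> :: ('x, 'a) mpoly set)"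
    unfolding complement_ideal_def ideal_gen_def by (intro ideal.span_base) auto
qed

lemma pommaret_basis_iff:
  assumes "order_ideal \<O>"
  shows "\<sigma> \<in> pommaret_basis (complement_ideal \<O> :: ('x::linorder, 'a::comm_ring_1) mpoly set)
    \<longleftrightarrow> \<sigma> \<notin> \<O> \<and> \<sigma> - var (min_var \<sigma>) \<in> \<O>"
  using order_ideal_zero[OF assms]
  by (auto simp: pommaret_basis_def monom_in_complement_ideal_iff[OF assms])

lemma pommaret_basis_subset_border:
  assumes "order_ideal \<O>"
  shows "pommaret_basis (complement_ideal \<O> :: ('x::linorder, 'a::comm_ring_1) mpoly set)
    \<subseteq> border \<O>"
proof
  fix \<sigma> assume "\<sigma> \<in> pommaret_basis (complement_ideal \<O> :: ('x, 'a) mpoly set)"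
  then have \<sigma>: "\<sigma> \<notin> \<O>" "\<sigma> - var (min_var \<sigma>) \<in> \<O>"
    by (simp_all add: pommaret_basis_iff[OF assms])
  then have "\<sigma> \<noteq> 0"
    using order_ideal_zero[OF assms] by auto
  then have "var (min_var \<sigma>) + (\<sigma> - var (min_var \<sigma>)) = \<sigma>"
    by (intro var_add_diff min_var_in_keys)
  then show "\<sigma> \<in> border \<O>"
    unfolding border_def using \<sigma>
    by (intro DiffI CollectI exI[of _ "min_var \<sigma>"] exI[of _ "\<sigma> - var (min_var \<sigma>)"]) simp_all
qed

text \<open>
  Divide \<open>\<sigma>\<close> by its minimal variable as long as the quotient stays outside \<open>\<O>\<close>. The last term
  outside \<open>\<O>\<close> is \<open>\<alpha>\<close>; each variable divided out was minimal when it was divided out, hence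
  is at most every variable that was left.
\<close>

lemma pommaret_decomposition:
  fixes \<O> :: "'x::linorder pp set"
  assumes "order_ideal \<O>" and "\<sigma> \<notin> \<O>"
  obtains \<alpha> \<eta> where "\<alpha> \<in> pommaret_basis (complement_ideal \<O> :: ('x, 'a::comm_ring_1) mpoly set)"
    and "\<sigma> = \<alpha> + \<eta>"
    and "\<And>x y. x \<in> Poly_Mapping.keys \<eta> \<Longrightarrow> y \<in> Poly_Mapping.keys \<alpha> \<Longrightarrow> x \<le> y"
proof -
  let ?P = "pommaret_basis (complement_ideal \<O> :: ('x, 'a) mpoly set)"
  have "\<exists>\<alpha> \<eta>. \<alpha> \<in> ?P \<and> \<sigma> = \<alpha> + \<eta> \<and>
      (\<forall>x\<in>Poly_Mapping.keys \<eta>. \<forall>y\<in>Poly_Mapping.keys \<alpha>. x \<le> y)"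
    using \<open>\<sigma> \<notin> \<O>\<close>
  proof (induction \<sigma> rule: pp_var_induct)
    case (1 \<sigma>)
    define m where "m = min_var \<sigma>"
    have "\<sigma> \<noteq> 0"
      using 1 order_ideal_zero[OF assms(1)] by auto
    then have m: "m \<in> Poly_Mapping.keys \<sigma>"
      unfolding m_def by (rule min_var_in_keys)
    show ?case
    proof (cases "\<sigma> - var m \<in> \<O>")
      case True
      then have "\<sigma> \<in> ?P"
        using 1 by (simp add: pommaret_basis_iff[OF assms(1)] m_def)
      then show ?thesis
        by (intro exI[of _ \<sigma>] exI[of _ 0]) simp
    next
      case False
      then obtain \<alpha> \<eta> where \<alpha>: "\<alpha> \<in> ?P" "\<sigma> - var m = \<alpha> + \<eta>"
        and le: "\<forall>x\<in>Poly_Mapping.keys \<eta>. \<forall>y\<in>Poly_Mapping.keys \<alpha>. x \<le> y"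
        using 1(1)[OF m] by blast
      have \<sigma>: "\<sigma> = \<alpha> + (var m + \<eta>)"
        using var_add_diff[OF m] \<alpha>(2) by (simp add: add.left_commute)
      have "Poly_Mapping.keys \<alpha> \<subseteq> Poly_Mapping.keys \<sigma>"
        by (subst \<sigma>) (auto simp: keys_add_pp)
      then have "m \<le> y" if "y \<in> Poly_Mapping.keys \<alpha>" for y
        unfolding m_def using that by (intro min_var_le) blast
      then show ?thesis
        using \<alpha>(1) \<sigma> le by (intro exI[of _ \<alpha>] exI[of _ "var m + \<eta>"]) (auto simp: keys_add_pp)
    qed
  qed
  then show thesis
    using that by blast
qed


section \<open>The ideal and the order ideal span all polynomials\<close>

lemma ideal_gen_mult: "p \<in> ideal_gen S \<Longrightarrow> q * p \<in> ideal_gen S"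
  unfolding ideal_gen_def by (rule ideal.span_scale)

lemma coeff_subspace_ideal_gen:
  "coeff.subspace (ideal_gen S :: ('x, 'a::comm_ring_1) mpoly set)"
  by (rule coeff.subspaceI)
    (simp_all add: coeff_scale_def ideal_gen_mult,
      simp_all add: ideal_gen_def ideal.span_zero ideal.span_add)

lemma coeff_subspace_sums:
  assumes "coeff.subspace U" and "coeff.subspace V"
  shows "coeff.subspace {u + v | u v. u \<in> U \<and> v \<in> V}"
proof (rule coeff.subspaceI)
  show "0 \<in> {u + v | u v. u \<in> U \<and> v \<in> V}"
    using assms coeff.subspace_0 by force
next
  fix p q assume "p \<in> {u + v | u v. u \<in> U \<and> v \<in> V}" "q \<in> {u + v | u v. u \<in> U \<and> v \<in> V}"
  then obtain u v u' v' where "p = u + v" "u \<in> U" "v \<in> V" "q = u' + v'" "u' \<in> U" "v' \<in> V"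
    by blast
  moreover from this have "p + q = (u + u') + (v + v')"
    by (simp add: ac_simps)
  ultimately show "p + q \<in> {u + v | u v. u \<in> U \<and> v \<in> V}"
    using coeff.subspace_add[OF assms(1)] coeff.subspace_add[OF assms(2)] by blast
next
  fix a p assume "p \<in> {u + v | u v. u \<in> U \<and> v \<in> V}"
  then obtain u v where "p = u + v" "u \<in> U" "v \<in> V"
    by blast
  moreover from this have "coeff_scale a p = coeff_scale a u + coeff_scale a v"
    by (simp add: coeff.scale_right_distrib)
  ultimately show "coeff_scale a p \<in> {u + v | u v. u \<in> U \<and> v \<in> V}"
    using coeff.subspace_scale[OF assms(1)] coeff.subspace_scale[OF assms(2)] by blast
qed

lemma mult_coeff_scale: "p * coeff_scale a q = coeff_scale a (p * q)"
  unfolding coeff_scale_def by (rule mult.left_commute)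

lemma coeff_span_monoms: "coeff.subspace V \<Longrightarrow> (\<And>\<tau>. monom \<tau> \<in> V) \<Longrightarrow> p \<in> V"
  for V :: "('x, 'a::comm_ring_1) mpoly set"
proof -
  assume V: "coeff.subspace V" "\<And>\<tau>. monom \<tau> \<in> V"
  have "p = (\<Sum>\<tau>\<in>Poly_Mapping.keys p. coeff_scale (Poly_Mapping.lookup p \<tau>) (monom \<tau>))"
    by (rule poly_mapping_eqI)
      (auto simp: coeff_scale_def monom_def mult_single lookup_sum lookup_single when_def
        in_keys_iff)
  also have "\<dots> \<in> V"
    using V by (intro coeff.subspace_sum coeff.subspace_scale)
  finally show "p \<in> V" .
qed

lemma monom_mult_closed:
  fixes V :: "('x, 'a::comm_ring_1) mpoly set"
  assumes "\<And>x p. x \<in> Poly_Mapping.keys \<eta> \<Longrightarrow> p \<in> V \<Longrightarrow> monom (var x) * p \<in> V" and "p \<in> V"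
  shows "monom \<eta> * p \<in> V"
  using assms
proof (induction \<eta> rule: pp_var_induct)
  case (1 \<eta>)
  show ?case
  proof (cases "\<eta> = 0")
    case True
    then show ?thesis
      using 1 by (simp add: monom_def)
  next
    case False
    then obtain x where x: "x \<in> Poly_Mapping.keys \<eta>"
      using keys_eq_empty by blast
    have "Poly_Mapping.keys (\<eta> - var x) \<subseteq> Poly_Mapping.keys \<eta>"
      using arg_cong[OF var_add_diff[OF x], of Poly_Mapping.keys] by (auto simp: keys_add_pp)
    then have "monom (\<eta> - var x) * p \<in> V"
      using 1 x by blast
    then have "monom (var x) * (monom (\<eta> - var x) * p) \<in> V"
      using 1(2) x by blast
    also have "monom (var x) * (monom (\<eta> - var x) * p) = monom \<eta> * p"
      using var_add_diff[OF x] by (simp flip: mult.assoc monom_add)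
    finally show ?thesis .
  qed
qed

text \<open>
  Unlike the usual argument that Pommaret reduction terminates, the proof uses no order on the
  terms: induction on the variable is enough, because the cofactor \<open>\<eta>\<close> of a term \<open>x \<tau>\<close> with \<open>\<tau> \<in> \<O>\<close>
  involves only variables smaller than \<open>x\<close>.
\<close>

lemma ideal_plus_term_module_UNIV:
  fixes \<O> :: "'x::{finite, linorder} pp set" and P :: "('x, 'a::comm_ring_1) marked set"
  assumes \<O>: "order_ideal \<O>"
    and P: "marked_set \<O> (pommaret_basis (complement_ideal \<O> :: ('x, 'a) mpoly set)) P"
  shows "{u + v | u v. u \<in> ideal_gen (poly_of ` P) \<and> v \<in> term_module \<O>} = UNIV"
proof -
  define V where "V = {u + v | u v. u \<in> ideal_gen (poly_of ` P) \<and> v \<in> term_module \<O>}"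
  have V: "coeff.subspace V"
    unfolding V_def term_module_def
    by (intro coeff_subspace_sums coeff_subspace_ideal_gen coeff.subspace_span)
  have ideal_V: "u \<in> V" if "u \<in> ideal_gen (poly_of ` P)" for u
    unfolding V_def term_module_def using that coeff.span_zero by force
  have term_V: "v \<in> V" if "v \<in> term_module \<O>" for v
    unfolding V_def ideal_gen_def using that ideal.span_zero by force
  have monom_V: "monom \<tau> \<in> V" if "\<tau> \<in> \<O>" for \<tau>
    using that by (intro term_V) (simp add: term_module_def coeff.span_base)

  have var_mult_closed: "monom (var x) * p \<in> V" if "p \<in> V" for x p
    using that
  proof (induction "card {y. y < x}" arbitrary: x p rule: less_induct)
    case less
    have IH: "monom (var y) * q \<in> V" if "y < x" "q \<in> V" for y q
      using that by (intro less.hyps psubset_card_mono) auto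
    have gen: "monom (var x + \<tau>) \<in> V" if "\<tau> \<in> \<O>" for \<tau>
    proof (cases "var x + \<tau> \<in> \<O>")
      case False
      obtain \<alpha> \<eta> where
        \<alpha>: "\<alpha> \<in> pommaret_basis (complement_ideal \<O> :: ('x, 'a) mpoly set)" and
        eq: "var x + \<tau> = \<alpha> + \<eta>" and
        le: "\<And>x y. x \<in> Poly_Mapping.keys \<eta> \<Longrightarrow> y \<in> Poly_Mapping.keys \<alpha> \<Longrightarrow> x \<le> y"
        using pommaret_decomposition[OF \<O> False] by blast
      have "\<alpha> \<notin> \<O>"
        using \<alpha> by (simp add: pommaret_basis_iff[OF \<O>])
      \<comment> \<open>Otherwise cancelling \<open>x\<close> would leave \<open>\<alpha>\<close> as a divisor of \<open>\<tau>\<close>.\<close>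
      have x_\<eta>: "x \<notin> Poly_Mapping.keys \<eta>"
      proof
        assume "x \<in> Poly_Mapping.keys \<eta>"
        then have "var x + \<tau> = var x + (\<alpha> + (\<eta> - var x))"
          using eq var_add_diff[of x \<eta>] by (simp add: add.left_commute)
        then have "\<tau> = \<alpha> + (\<eta> - var x)"
          by simp
        then show False
          using \<open>\<tau> \<in> \<O>\<close> \<open>\<alpha> \<notin> \<O>\<close> order_ideal_addD[OF \<O>] by blast
      qed
      have "x \<in> Poly_Mapping.keys (\<alpha> + \<eta>)"
        by (simp add: keys_add_pp flip: eq)
      then have "x \<in> Poly_Mapping.keys \<alpha>"
        using x_\<eta> by (simp add: keys_add_pp)
      then have small: "y < x" if "y \<in> Poly_Mapping.keys \<eta>" for y
        using le that x_\<eta> by (metis order_le_less)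
      obtain f where f: "f \<in> P" "Ht f = \<alpha>" "poly_of f - monom \<alpha> \<in> term_module \<O>"
        using P \<alpha> unfolding marked_set_def bij_betw_def by force
      have "monom \<eta> * poly_of f \<in> V"
        using f(1) by (intro ideal_V ideal_gen_mult) (simp add: ideal_gen_def ideal.span_base)
      moreover have "monom \<eta> * (poly_of f - monom \<alpha>) \<in> V"
        by (rule monom_mult_closed) (simp_all add: IH small term_V f(3))
      moreover have "monom (var x + \<tau>) = monom \<eta> * poly_of f - monom \<eta> * (poly_of f - monom \<alpha>)"
        unfolding eq by (simp add: monom_add algebra_simps)
      ultimately show ?thesis
        using coeff.subspace_diff[OF V] by simp
    qed (rule monom_V)
    obtain u v where p: "p = u + v" "u \<in> ideal_gen (poly_of ` P)" "v \<in> term_module \<O>"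
      using less.prems unfolding V_def by blast
    have "coeff.subspace {q. monom (var x) * q \<in> V}"
      using V by (intro coeff.subspaceI)
        (simp_all add: coeff.subspace_0 coeff.subspace_add coeff.subspace_scale
          distrib_left mult_coeff_scale)
    then have "term_module \<O> \<subseteq> {q. monom (var x) * q \<in> V}"
      unfolding term_module_def using gen by (intro coeff.span_minimal) (auto simp: monom_add)
    then show ?case
      using p(1,3) ideal_V[OF ideal_gen_mult[OF p(2)]]
      by (auto simp: distrib_left intro!: coeff.subspace_add[OF V])
  qed

  have "p \<in> V" for p
  proof (rule coeff_span_monoms[OF V])
    fix \<tau>
    have "monom \<tau> * monom 0 \<in> V"
      by (rule monom_mult_closed) (simp_all add: var_mult_closed monom_V order_ideal_zero[OF \<O>])
    then show "monom \<tau> \<in> V"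
      by (simp flip: monom_add)
  qed
  then show ?thesis
    unfolding V_def[symmetric] by blast
qed


section \<open>Comparison of the two marked sets\<close>

lemma marked_set_restrict:
  assumes "marked_set \<O> H F" and "H' \<subseteq> H"
  shows "marked_set \<O> H' {f \<in> F. Ht f \<in> H'}"
proof -
  have "bij_betw Ht F H"
    using assms(1) by (simp add: marked_set_def)
  then have "bij_betw Ht {f \<in> F. Ht f \<in> H'} H'"
    by (rule bij_betw_subset) (use \<open>bij_betw Ht F H\<close> assms(2) in \<open>auto simp: bij_betw_def\<close>)
  then show ?thesis
    using assms(1) by (simp add: marked_set_def)
qed

lemma ideal_gen_eqI:
  assumes "S \<subseteq> T" and "T \<subseteq> ideal_gen S"
  shows "ideal_gen S = ideal_gen T"
  using assms unfolding ideal_gen_def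
  by (intro equalityI ideal.span_mono ideal.span_minimal ideal.subspace_span)

text \<open>
  An instance of the modular law: the component in \<open>V\<close> of an element of the larger ideal is a
  difference of elements of that ideal, so it lies in the trivial intersection.
\<close>

lemma ideal_gen_subset_of_common_complement:
  fixes S T :: "('x, 'a::comm_ring_1) mpoly set"
  assumes "ideal_gen S \<subseteq> ideal_gen T"
    and "{u + v | u v. u \<in> ideal_gen S \<and> v \<in> V} = UNIV"
    and "ideal_gen T \<inter> V = {0}"
  shows "ideal_gen T \<subseteq> ideal_gen S"
proof
  fix p assume p: "p \<in> ideal_gen T"
  obtain u v where uv: "p = u + v" "u \<in> ideal_gen S" "v \<in> V"
    using assms(2) by blast
  have "p - u \<in> ideal_gen T"
    using p uv(2) assms(1) unfolding ideal_gen_def by (intro ideal.span_diff) auto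
  then have "v = 0"
    using uv assms(3) by auto
  then show "p \<in> ideal_gen S"
    using uv by simp
qed

theorem theorem2p3:
  fixes scale :: "'k::field \<Rightarrow> 'a::comm_ring_1 \<Rightarrow> 'a"
    and \<O> :: "'x::{finite, linorder} pp set"
    and B P B' :: "('x, 'a) marked set"
    and P\<^sub>O :: "'x pp set"
  assumes "K_algebra scale"
    and "noetherian TYPE('a)"
    and "order_ideal \<O>" and "finite \<O>"
    and "P\<^sub>O = pommaret_basis (complement_ideal \<O> :: ('x, 'a) mpoly set)"
    and "marked_set \<O> (border \<O>) B"
    and "P = {f \<in> B. Ht f \<in> P\<^sub>O}"
    and "B' = B - P"
  shows "marked_basis \<O> (border \<O>) B \<longleftrightarrow>
    marked_basis \<O> P\<^sub>O P \<and> poly_of ` B' \<subseteq> ideal_gen (poly_of ` P)"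
proof -
  have P_sub: "poly_of ` P \<subseteq> poly_of ` B"
    using assms(7) by blast
  have P_marked: "marked_set \<O> P\<^sub>O P"
    unfolding assms(7) using assms(6)
    by (rule marked_set_restrict) (simp add: assms(5) pommaret_basis_subset_border[OF assms(3)])
  have sum: "{u + v | u v. u \<in> ideal_gen (poly_of ` P) \<and> v \<in> term_module \<O>} = UNIV"
    using ideal_plus_term_module_UNIV[OF assms(3)] P_marked assms(5) by blast
  have same_ideal: "poly_of ` B' \<subseteq> ideal_gen (poly_of ` P)
      \<longleftrightarrow> ideal_gen (poly_of ` P) = ideal_gen (poly_of ` B)"
  proof
    assume "poly_of ` B' \<subseteq> ideal_gen (poly_of ` P)"
    moreover have "poly_of ` P \<subseteq> ideal_gen (poly_of ` P)"
      by (simp add: ideal_gen_def ideal.span_superset)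
    ultimately have "poly_of ` B \<subseteq> ideal_gen (poly_of ` P)"
      using assms(8) by blast
    then show "ideal_gen (poly_of ` P) = ideal_gen (poly_of ` B)"
      using P_sub by (intro ideal_gen_eqI)
  next
    assume "ideal_gen (poly_of ` P) = ideal_gen (poly_of ` B)"
    moreover have "poly_of ` B \<subseteq> ideal_gen (poly_of ` B)"
      by (simp add: ideal_gen_def ideal.span_superset)
    ultimately show "poly_of ` B' \<subseteq> ideal_gen (poly_of ` P)"
      using assms(8) by blast
  qed
  have "ideal_gen (poly_of ` P) = ideal_gen (poly_of ` B)" if "marked_basis \<O> (border \<O>) B"
  proof
    show le: "ideal_gen (poly_of ` P) \<subseteq> ideal_gen (poly_of ` B)"
      unfolding ideal_gen_def by (rule ideal.span_mono[OF P_sub])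
    show "ideal_gen (poly_of ` B) \<subseteq> ideal_gen (poly_of ` P)"
      using that ideal_gen_subset_of_common_complement[OF le sum]
      by (simp add: marked_basis_def whole_is_direct_sum_def)
  qed
  then show ?thesis
    using P_marked assms(6) unfolding same_ideal marked_basis_def by auto
qed

end
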